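(* Let $K\subseteq V_{\mathbf B}$ be a class of $\mathbf B$-models and let $(M_1,w_1)$ and $(M_2,w_2)$ be two pointed models with $M_1,M_2\in K$, with sets of worlds $W_1,W_2$. Let $\kappa$ be the least infinite cardinal $\geq\sup\{|W_1|,|W_2|\}$ and $\lambda=\sup\{|\mathtt{PROP}|,2^{\kappa}\}$. Then, when $\{i,j\}=\{1,2\}$, there is a formula $\theta^{w_i}$ of $L_{\lambda^+\omega}^{\rightarrow}$ such that (1) $M_i,w_i\Vdash\theta^{w_i}$, and (2) $M_j,w_j\Vdash\theta^{w_i}$ if and only if there is a relevant directed bisimulation $\langle Z_1,Z_2\rangle$ for $\mathtt{PROP}$ between $M_1$ and $M_2$ such that $w_iZ_iw_j$.
   Context: Language. Given a set $\mathtt{PROP}$ of propositional variables and an infinite cardinal $\mu$, the formulas of $L_{\mu\omega}^{\rightarrow}$ are generated by $\phi ::= p \mid \bot \mid {\sim}\phi \mid \bigwedge_{i\in I}\phi_i \mid \bigvee_{i\in I}\phi_i \mid \phi\rightarrow\psi$, with $p\in\mathtt{PROP}$ and $|I|<\mu$. Models. A (Routley–Meyer) model is $M=\langle W,R,*,T,V\rangle$ with $W$ a non-empty set, $T\in W$, $*:W\to W$ (written $w\mapsto w^*$), $R\subseteq W^3$, and $V:\mathtt{PROP}\to\wp(W)$. A pointed model is a pair $(M,w)$ with $w\in W$. Satisfaction: $M,w\Vdash\bot$ never; $M,w\Vdash p$ iff $w\in V(p)$; $M,w\Vdash{\sim}\phi$ iff $M,w^*\nVdash\phi$; $M,w\Vdash\bigwedge_{i\in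 I}\phi_i$ iff $M,w\Vdash\phi_i$ for every $i\in I$; $M,w\Vdash\bigvee_{i\in I}\phi_i$ iff $M,w\Vdash\phi_i$ for some $i\in I$; $M,w\Vdash\phi\rightarrow\psi$ iff for all $a,b$ with $Rwab$, if $M,a\Vdash\phi$ then $M,b\Vdash\psi$. A $\mathbf B$-model is a model such that for all $x,y,z,v\in W$: $RTxx$; $RTxv$ and $Rvyz$ imply $Rxyz$; $x=x^{**}$; $RTxy$ implies $RTy^*x^*$; and $x\in V(p)$ and $RTxy$ imply $y\in V(p)$ for all $p\in\mathtt{PROP}$. $V_{\mathbf B}$ is the class of all $\mathbf B$-models. Relevant directed bisimulations. Let $M_1,M_2$ be models with components $W_m,R_m,*_m,V_m$ ($m=1,2$). A relevant directed bisimulation for $\mathtt{PROP}$ between $M_1$ and $M_2$ is a pair $\langle Z_1,Z_2\rangle$ of non-empty relations $Z_1\subseteq W_1\times W_2$, $Z_2\subseteq W_2\times W_1$ such that whenever $\{i,j\}=\{1,2\}$: (1) $xZ_iy$ only if $y^{*_j}Z_jx^{*_i}$; (2) if $xZ_iy$ and $R_jybc$ for some $b,c\in W_j$, there are $b',c'\in W_i$ such that $R_ixb'c'$, $bZ_jb'$ and $c'Z_ic$; (3) if $xZ_iy$ and $p\in\mathtt{PROP}$, then $M_i,x\Vdash p$ only if $M_j,y\Vdash p$. *)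

theory Defs
  imports Main
begin

unbundle cardinal_syntax

(* Conj I f and Disj I f stand for the conjunction and disjunction of the family f restricted
   to the index set I; the values of f outside I play no role. *)
datatype ('p, 'i) fm =
    Var 'p
  | Bot
  | Neg "('p, 'i) fm"
  | Conj "'i set" "'i \<Rightarrow> ('p, 'i) fm"
  | Disj "'i set" "'i \<Rightarrow> ('p, 'i) fm"
  | Imp "('p, 'i) fm" "('p, 'i) fm"

(* The language over the set AP of variables and the infinite cardinal \<mu>.  Index sets are
   subsets of the type 'i, so all index sets of size < \<mu> occur up to reindexing as soon as every
   cardinal below \<mu> embeds into 'i.  For the successor of a cardinal \<Lambda> :: 'i rel this is
   automatic, since every set of size at most \<Lambda> embeds into the field of \<Lambda>. *)
inductive_set Lang :: "'m rel \<Rightarrow> 'p set \<Rightarrow> ('p, 'i) fm set"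
  for \<mu> :: "'m rel" and AP :: "'p set" where
  Var: "p \<in> AP \<Longrightarrow> Var p \<in> Lang \<mu> AP"
| Bot: "Bot \<in> Lang \<mu> AP"
| Neg: "\<phi> \<in> Lang \<mu> AP \<Longrightarrow> Neg \<phi> \<in> Lang \<mu> AP"
| Conj: "|I| <o \<mu> \<Longrightarrow> (\<And>i. i \<in> I \<Longrightarrow> f i \<in> Lang \<mu> AP) \<Longrightarrow> Conj I f \<in> Lang \<mu> AP"
| Disj: "|I| <o \<mu> \<Longrightarrow> (\<And>i. i \<in> I \<Longrightarrow> f i \<in> Lang \<mu> AP) \<Longrightarrow> Disj I f \<in> Lang \<mu> AP"
| Imp: "\<phi> \<in> Lang \<mu> AP \<Longrightarrow> \<psi> \<in> Lang \<mu> AP \<Longrightarrow> Imp \<phi> \<psi> \<in> Lang \<mu> AP"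

record ('w, 'p) rm_struct =
  worlds :: "'w set"
  acc :: "('w \<times> 'w \<times> 'w) set"
  star :: "'w \<Rightarrow> 'w"
  base :: 'w
  val :: "'p \<Rightarrow> 'w set"

definition rm_model :: "'p set \<Rightarrow> ('w, 'p) rm_struct \<Rightarrow> bool" where
  "rm_model AP M \<longleftrightarrow>
     worlds M \<noteq> {} \<and>
     base M \<in> worlds M \<and>
     (\<forall>x\<in>worlds M. star M x \<in> worlds M) \<and>
     acc M \<subseteq> worlds M \<times> worlds M \<times> worlds M \<and>
     (\<forall>p\<in>AP. val M p \<subseteq> worlds M)"

primrec sat :: "('w, 'p) rm_struct \<Rightarrow> ('p, 'i) fm \<Rightarrow> 'w \<Rightarrow> bool" where
  "sat M (Var p) w \<longleftrightarrow> w \<in> val M p"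
| "sat M Bot w \<longleftrightarrow> False"
| "sat M (Neg \<phi>) w \<longleftrightarrow> \<not> sat M \<phi> (star M w)"
| "sat M (Conj I f) w \<longleftrightarrow> (\<forall>i\<in>I. sat M (f i) w)"
| "sat M (Disj I f) w \<longleftrightarrow> (\<exists>i\<in>I. sat M (f i) w)"
| "sat M (Imp \<phi> \<psi>) w \<longleftrightarrow> (\<forall>a b. (w, a, b) \<in> acc M \<longrightarrow> sat M \<phi> a \<longrightarrow> sat M \<psi> b)"

definition V_B :: "'p set \<Rightarrow> ('w, 'p) rm_struct set" where
  "V_B AP = {M. rm_model AP M \<and>
     (\<forall>x\<in>worlds M. (base M, x, x) \<in> acc M) \<and>
     (\<forall>x\<in>worlds M. \<forall>y\<in>worlds M. \<forall>z\<in>worlds M. \<forall>v\<in>worlds M.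
        (base M, x, v) \<in> acc M \<and> (v, y, z) \<in> acc M \<longrightarrow> (x, y, z) \<in> acc M) \<and>
     (\<forall>x\<in>worlds M. x = star M (star M x)) \<and>
     (\<forall>x\<in>worlds M. \<forall>y\<in>worlds M.
        (base M, x, y) \<in> acc M \<longrightarrow> (base M, star M y, star M x) \<in> acc M) \<and>
     (\<forall>x\<in>worlds M. \<forall>y\<in>worlds M. \<forall>p\<in>AP.
        x \<in> val M p \<and> (base M, x, y) \<in> acc M \<longrightarrow> y \<in> val M p)}"

(* The three clauses for one ordering (i, j) of the indices: M, Z carry the index i and
   N, Z' the index j. *)
definition directed_clauses ::
  "'p set \<Rightarrow> ('a, 'p) rm_struct \<Rightarrow> ('b, 'p) rm_struct \<Rightarrow> ('a \<times> 'b) set \<Rightarrow> ('b \<times> 'a) set \<Rightarrow> bool"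
where
  "directed_clauses AP M N Z Z' \<longleftrightarrow>
     (\<forall>x y. (x, y) \<in> Z \<longrightarrow> (star N y, star M x) \<in> Z') \<and>
     (\<forall>x y. (x, y) \<in> Z \<longrightarrow> (\<forall>b\<in>worlds N. \<forall>c\<in>worlds N. (y, b, c) \<in> acc N \<longrightarrow>
        (\<exists>b'\<in>worlds M. \<exists>c'\<in>worlds M. (x, b', c') \<in> acc M \<and> (b, b') \<in> Z' \<and> (c', c) \<in> Z))) \<and>
     (\<forall>x y. (x, y) \<in> Z \<longrightarrow> (\<forall>p\<in>AP. x \<in> val M p \<longrightarrow> y \<in> val N p))"

definition relevant_directed_bisimulation ::
  "'p set \<Rightarrow> ('a, 'p) rm_struct \<Rightarrow> ('b, 'p) rm_struct \<Rightarrow> ('a \<times> 'b) set \<Rightarrow> ('b \<times> 'a) set \<Rightarrow> bool"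
where
  "relevant_directed_bisimulation AP M1 M2 Z1 Z2 \<longleftrightarrow>
     Z1 \<noteq> {} \<and> Z1 \<subseteq> worlds M1 \<times> worlds M2 \<and>
     Z2 \<noteq> {} \<and> Z2 \<subseteq> worlds M2 \<times> worlds M1 \<and>
     directed_clauses AP M1 M2 Z1 Z2 \<and>
     directed_clauses AP M2 M1 Z2 Z1"

(* In the next two definitions minimality is only required among cardinals on the type 'k.  This
   is no restriction: every cardinal strictly below one on 'k has an isomorphic copy on 'k. *)
definition least_infinite_cardinal_above :: "'k rel \<Rightarrow> 'a rel \<Rightarrow> 'b rel \<Rightarrow> bool" where
  "least_infinite_cardinal_above \<kappa> r s \<longleftrightarrow>
     Cinfinite \<kappa> \<and> r \<le>o \<kappa> \<and> s \<le>o \<kappa> \<and>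
     (\<forall>\<nu> :: 'k rel. Cinfinite \<nu> \<and> r \<le>o \<nu> \<and> s \<le>o \<nu> \<longrightarrow> \<kappa> \<le>o \<nu>)"

definition cardinal_sup :: "'k rel \<Rightarrow> 'a rel \<Rightarrow> 'b rel \<Rightarrow> bool" where
  "cardinal_sup \<Lambda> r s \<longleftrightarrow>
     Card_order \<Lambda> \<and> r \<le>o \<Lambda> \<and> s \<le>o \<Lambda> \<and>
     (\<forall>\<nu> :: 'k rel. Card_order \<nu> \<and> r \<le>o \<nu> \<and> s \<le>o \<nu> \<longrightarrow> \<Lambda> \<le>o \<nu>)"

lemma least_infinite_cardinal_above_csum:
  assumes "Card_order r" "Card_order s"
  shows "least_infinite_cardinal_above (natLeq +c (r +c s)) r s"
proof -
  have "r \<le>o r +c s" "s \<le>o r +c s" "r +c s \<le>o natLeq +c (r +c s)"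
    using assms by (auto intro: ordLeq_csum1 ordLeq_csum2 Card_order_csum)
  moreover have "Cinfinite (natLeq +c (r +c s))"
    by (intro Cinfinite_csum1 natLeq_Cinfinite)
  moreover have "natLeq +c (r +c s) \<le>o \<nu>" if "Cinfinite \<nu>" "r \<le>o \<nu>" "s \<le>o \<nu>"
    for \<nu> :: "(nat + 'a + 'b) rel"
    using that assms
    by (intro csum_cinfinite_bound natLeq_ordLeq_cinfinite natLeq_Card_order Card_order_csum)
  ultimately show ?thesis
    unfolding least_infinite_cardinal_above_def by (meson ordLeq_transitive)
qed

lemma cardinal_sup_csum:
  assumes "Card_order r" "Cinfinite s"
  shows "cardinal_sup (r +c s) r s"
proof -
  have "Cinfinite \<nu>" if "Card_order \<nu>" "s \<le>o \<nu>" for \<nu> :: "('a + 'b) rel"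
    using assms(2) that by (meson cinfinite_mono)
  then show ?thesis
    using assms unfolding cardinal_sup_def
    by (auto intro: ordLeq_csum1 ordLeq_csum2 Card_order_csum csum_cinfinite_bound)
qed

end

theory Submission
  imports Defs
begin

text \<open>
  The relations ``every formula of the language true at \<open>x\<close> is true at \<open>y\<close>'' form a relevant
  directed bisimulation: if its clause for the ternary relation failed at \<open>x\<close> and \<open>R y b c\<close>, then
  conjoining formulas of \<open>b\<close> and disjoining formulas refuted at \<open>c\<close>, one for each world of the other
  model, would give an implication true at \<open>x\<close> and false at \<open>y\<close>.
  Hence if \<open>w\<^sub>i Z\<^sub>i w\<^sub>j\<close> holds for no bisimulation, some formula is true at \<open>w\<^sub>i\<close> and false at \<open>w\<^sub>j\<close>;
  otherwise any formula valid in both models serves, since the two pointed models are given in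
  advance and the formula may depend on both.
\<close>

text \<open>Index sets of formulas live in the type \<open>'l\<close> underlying \<Lambda>, so a
  family over worlds must first be transported along an injection into
  \<open>Field \<Lambda>\<close>. Size at most \<Lambda> is the same as size below its
  successor.\<close>

lemma index_set_ex:
  fixes \<Lambda> :: "'l rel" and A :: "'a set"
  assumes "Card_order \<Lambda>" and "|A| \<le>o \<Lambda>"
  obtains h :: "'a \<Rightarrow> 'l" where "inj_on h A" and "|h ` A| <o cardSuc \<Lambda>"
proof -
  have "|A| \<le>o |Field \<Lambda>|"
    using assms card_of_Field_ordIso ordIso_symmetric ordLeq_ordIso_trans by blast
  then obtain h :: "'a \<Rightarrow> 'l" where h: "inj_on h A"
    using card_of_ordLeq[of A "Field \<Lambda>"] by blast
  have "|h ` A| \<le>o \<Lambda>"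
    using assms(2) card_of_image ordLeq_transitive by blast
  then have "|h ` A| <o cardSuc \<Lambda>"
    using assms(1) cardSuc_ordLeq_ordLess card_of_Card_order by blast
  with h show thesis by (rule that)
qed

text \<open>The formula is fixed before the model, so that it can later be evaluated in both models
  over \<open>'w\<close>; reindexing along \<open>inv_into A h\<close> recovers the original
  family.\<close>

lemma Lang_conj_ex:
  fixes \<Lambda> :: "'l rel" and g :: "'a \<Rightarrow> ('p, 'l) fm"
  assumes "Card_order \<Lambda>" and "|A| \<le>o \<Lambda>" and "\<And>a. a \<in> A \<Longrightarrow> g a \<in> Lang (cardSuc \<Lambda>) AP"
  obtains \<phi> :: "('p, 'l) fm" where "\<phi> \<in> Lang (cardSuc \<Lambda>) AP"
    and "\<And>(M :: ('w, 'p) rm_struct) w. sat M \<phi> w \<longleftrightarrow> (\<forall>a\<in>A. sat M (g a) w)"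
proof -
  obtain h :: "'a \<Rightarrow> 'l" where h: "inj_on h A" "|h ` A| <o cardSuc \<Lambda>"
    using index_set_ex assms(1,2) by blast
  let ?\<phi> = "Conj (h ` A) (g \<circ> inv_into A h)"
  have "?\<phi> \<in> Lang (cardSuc \<Lambda>) AP"
    using h assms(3) by (intro Lang.Conj) auto
  moreover have "sat M ?\<phi> w \<longleftrightarrow> (\<forall>a\<in>A. sat M (g a) w)" for M :: "('w, 'p) rm_struct" and w
    using h(1) by simp
  ultimately show thesis by (rule that)
qed

lemma Lang_disj_ex:
  fixes \<Lambda> :: "'l rel" and g :: "'a \<Rightarrow> ('p, 'l) fm"
  assumes "Card_order \<Lambda>" and "|A| \<le>o \<Lambda>" and "\<And>a. a \<in> A \<Longrightarrow> g a \<in> Lang (cardSuc \<Lambda>) AP"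
  obtains \<phi> :: "('p, 'l) fm" where "\<phi> \<in> Lang (cardSuc \<Lambda>) AP"
    and "\<And>(M :: ('w, 'p) rm_struct) w. sat M \<phi> w \<longleftrightarrow> (\<exists>a\<in>A. sat M (g a) w)"
proof -
  obtain h :: "'a \<Rightarrow> 'l" where h: "inj_on h A" "|h ` A| <o cardSuc \<Lambda>"
    using index_set_ex assms(1,2) by blast
  let ?\<phi> = "Disj (h ` A) (g \<circ> inv_into A h)"
  have "?\<phi> \<in> Lang (cardSuc \<Lambda>) AP"
    using h assms(3) by (intro Lang.Disj) auto
  moreover have "sat M ?\<phi> w \<longleftrightarrow> (\<exists>a\<in>A. sat M (g a) w)" for M :: "('w, 'p) rm_struct" and w
    using h(1) by simp
  ultimately show thesis by (rule that)
qed

definition preservation ::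
  "('p, 'i) fm set \<Rightarrow> ('a, 'p) rm_struct \<Rightarrow> ('b, 'p) rm_struct \<Rightarrow> ('a \<times> 'b) set"
where
  "preservation L M N =
     {(x, y) \<in> worlds M \<times> worlds N. \<forall>\<phi>\<in>L. sat M \<phi> x \<longrightarrow> sat N \<phi> y}"

text \<open>Contraposition of preservation applied to \<open>Neg \<phi>\<close>: negation turns
  truth at a world into falsity at its star, which reverses the direction.\<close>

lemma preservation_star:
  fixes \<mu> :: "'m rel" and AP :: "'p set"
  defines "L \<equiv> Lang \<mu> AP :: ('p, 'i) fm set"
  assumes "rm_model AP M" and "rm_model AP N"
    and xy: "(x, y) \<in> preservation L M N"
  shows "(star N y, star M x) \<in> preservation L N M"
proof -
  have "sat M \<phi> (star M x)" if "\<phi> \<in> L" "sat N \<phi> (star N y)" for \<phi>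
  proof -
    have "Neg \<phi> \<in> L"
      using that(1) unfolding L_def by (rule Lang.Neg)
    then have "sat M (Neg \<phi>) x \<longrightarrow> sat N (Neg \<phi>) y"
      using xy unfolding preservation_def by blast
    then show ?thesis using that(2) by simp
  qed
  then show ?thesis
    using assms(2-4) unfolding preservation_def rm_model_def by auto
qed

text \<open>Only the size of \<open>M\<close> is bounded: the separating implication takes at most
  one conjunct and one disjunct per world of \<open>M\<close>, the model in which the matching pair
  is sought.\<close>

lemma preservation_acc:
  fixes M N :: "('w, 'p) rm_struct" and \<Lambda> :: "'l rel" and AP :: "'p set"
  defines "L \<equiv> Lang (cardSuc \<Lambda>) AP :: ('p, 'l) fm set"
  assumes "Card_order \<Lambda>" and "|worlds M| \<le>o \<Lambda>" and "rm_model AP M"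
    and xy: "(x, y) \<in> preservation L M N"
    and bc: "b \<in> worlds N" "c \<in> worlds N" "(y, b, c) \<in> acc N"
  shows "\<exists>b'\<in>worlds M. \<exists>c'\<in>worlds M.
           (x, b', c') \<in> acc M \<and> (b, b') \<in> preservation L N M \<and> (c', c) \<in> preservation L M N"
proof (rule ccontr)
  assume no: "\<not> ?thesis"
  \<comment> \<open>\<open>B\<close> and \<open>C\<close> collect the worlds that cannot match
    \<open>b\<close> and \<open>c\<close>. Without a matching pair, every \<open>(x, b', c')\<close>
    in \<open>acc M\<close> has \<open>b'\<close> in \<open>B\<close> or \<open>c'\<close> in
    \<open>C\<close>. If \<open>B\<close> is empty, \<phi> is true everywhere; if \<open>C\<close>
    is empty, \<psi> is false everywhere.\<close>
  define B where "B = {b' \<in> worlds M. (b, b') \<notin> preservation L N M}"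
  define C where "C = {c' \<in> worlds M. (c', c) \<notin> preservation L M N}"
  have "B \<subseteq> worlds M" "C \<subseteq> worlds M"
    unfolding B_def C_def by auto
  then have card: "|B| \<le>o \<Lambda>" "|C| \<le>o \<Lambda>"
    using assms(3) card_of_mono1 ordLeq_transitive by blast+
  have "\<forall>b'\<in>B. \<exists>\<phi>\<in>L. sat N \<phi> b \<and> \<not> sat M \<phi> b'"
    using bc unfolding B_def preservation_def by blast
  then obtain g where g: "\<And>b'. b' \<in> B \<Longrightarrow> g b' \<in> L \<and> sat N (g b') b \<and> \<not> sat M (g b') b'"
    by metis
  have "\<forall>c'\<in>C. \<exists>\<psi>\<in>L. sat M \<psi> c' \<and> \<not> sat N \<psi> c"
    using bc unfolding C_def preservation_def by blast
  then obtain k where k: "\<And>c'. c' \<in> C \<Longrightarrow> k c' \<in> L \<and> sat M (k c') c' \<and> \<not> sat N (k c') c"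
    by metis
  obtain \<phi> where \<phi>: "\<phi> \<in> L"
      "\<And>(M :: ('w, 'p) rm_struct) w. sat M \<phi> w \<longleftrightarrow> (\<forall>b'\<in>B. sat M (g b') w)"
    using Lang_conj_ex[OF assms(2) card(1), of g AP] g unfolding L_def by blast
  obtain \<psi> where \<psi>: "\<psi> \<in> L"
      "\<And>(M :: ('w, 'p) rm_struct) w. sat M \<psi> w \<longleftrightarrow> (\<exists>c'\<in>C. sat M (k c') w)"
    using Lang_disj_ex[OF assms(2) card(2), of k AP] k unfolding L_def by blast
  have "sat M \<psi> c'" if "(x, b', c') \<in> acc M" "sat M \<phi> b'" for b' c'
  proof -
    have worlds: "b' \<in> worlds M" "c' \<in> worlds M"
      using that(1) \<open>rm_model AP M\<close> unfolding rm_model_def by auto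
    \<comment> \<open>A world in \<open>B\<close> refutes its own conjunct \<open>g b'\<close>. Thus
      the failure must lie with \<open>c'\<close>, whose own disjunct \<open>k c'\<close> makes
      \<psi> true.\<close>
    have "b' \<notin> B"
      using that(2) \<phi>(2) g by blast
    then have "c' \<in> C"
      using no that(1) worlds unfolding B_def C_def by blast
    then show ?thesis using \<psi>(2) k by blast
  qed
  then have "sat M (Imp \<phi> \<psi>) x" by simp
  moreover have "Imp \<phi> \<psi> \<in> L"
    using \<phi>(1) \<psi>(1) unfolding L_def by (rule Lang.Imp)
  ultimately have "sat N (Imp \<phi> \<psi>) y"
    using xy unfolding preservation_def by blast
  moreover have "sat N \<phi> b" using \<phi>(2) g by blast
  ultimately have "sat N \<psi> c" using bc(3) by simp
  then show False using \<psi>(2) k by blast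
qed

lemma directed_clauses_preservation:
  fixes M N :: "('w, 'p) rm_struct" and \<Lambda> :: "'l rel" and AP :: "'p set"
  defines "L \<equiv> Lang (cardSuc \<Lambda>) AP :: ('p, 'l) fm set"
  assumes "Card_order \<Lambda>" and "|worlds M| \<le>o \<Lambda>" and "rm_model AP M" and "rm_model AP N"
  shows "directed_clauses AP M N (preservation L M N) (preservation L N M)"
proof -
  have "y \<in> val N p" if "(x, y) \<in> preservation L M N" "p \<in> AP" "x \<in> val M p" for x y p
  proof -
    have "Var p \<in> L"
      using that(2) unfolding L_def by (rule Lang.Var)
    then have "sat M (Var p :: ('p, 'l) fm) x \<longrightarrow> sat N (Var p :: ('p, 'l) fm) y"
      using that(1) unfolding preservation_def by blast
    then show ?thesis using that(3) by simp
  qed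
  moreover have "(star N y, star M x) \<in> preservation L N M"
    if "(x, y) \<in> preservation L M N" for x y
    using preservation_star[OF assms(4,5)] that unfolding L_def .
  moreover have "\<exists>b'\<in>worlds M. \<exists>c'\<in>worlds M.
      (x, b', c') \<in> acc M \<and> (b, b') \<in> preservation L N M \<and> (c', c) \<in> preservation L M N"
    if "(x, y) \<in> preservation L M N" "b \<in> worlds N" "c \<in> worlds N" "(y, b, c) \<in> acc N"
    for x y b c
    using preservation_acc[OF assms(2-4)] that unfolding L_def .
  ultimately show ?thesis
    unfolding directed_clauses_def by blast
qed

lemma preservation_bisimulation:
  fixes M N :: "('w, 'p) rm_struct" and \<Lambda> :: "'l rel" and AP :: "'p set"
  defines "L \<equiv> Lang (cardSuc \<Lambda>) AP :: ('p, 'l) fm set"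
  assumes "Card_order \<Lambda>" and "|worlds M| \<le>o \<Lambda>" and "|worlds N| \<le>o \<Lambda>"
    and "rm_model AP M" and "rm_model AP N"
    and "(x, y) \<in> preservation L M N"
  shows "relevant_directed_bisimulation AP M N (preservation L M N) (preservation L N M)"
proof -
  \<comment> \<open>This pair witnesses that the second relation is non-empty; the given pair does
    so for the first.\<close>
  have "(star N y, star M x) \<in> preservation L N M"
    using assms(5-7) unfolding L_def by (rule preservation_star)
  moreover have "preservation L M N \<subseteq> worlds M \<times> worlds N"
    "preservation L N M \<subseteq> worlds N \<times> worlds M"
    unfolding preservation_def by auto
  ultimately show ?thesis
    using assms directed_clauses_preservation
    unfolding relevant_directed_bisimulation_def L_def by blast
qed

lemma separating_formula_ex:
  fixes M N :: "('w, 'p) rm_struct" and \<Lambda> :: "'l rel" and AP :: "'p set"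
  assumes "Card_order \<Lambda>" and "|worlds M| \<le>o \<Lambda>" and "|worlds N| \<le>o \<Lambda>"
    and "rm_model AP M" and "rm_model AP N"
    and "x \<in> worlds M" and "y \<in> worlds N"
  shows "\<exists>\<theta> :: ('p, 'l) fm. \<theta> \<in> Lang (cardSuc \<Lambda>) AP \<and> sat M \<theta> x \<and>
           (sat N \<theta> y \<longleftrightarrow>
              (\<exists>Z Z'. relevant_directed_bisimulation AP M N Z Z' \<and> (x, y) \<in> Z))"
proof (cases "\<exists>Z Z'. relevant_directed_bisimulation AP M N Z Z' \<and> (x, y) \<in> Z")
  case True
  have "Neg Bot \<in> Lang (cardSuc \<Lambda>) AP"
    by (intro Lang.Neg Lang.Bot)
  with True show ?thesis by (intro exI[of _ "Neg Bot"]) simp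
next
  case False
  let ?L = "Lang (cardSuc \<Lambda>) AP :: ('p, 'l) fm set"
  \<comment> \<open>Otherwise the preservation relations would be a bisimulation linking
    \<open>x\<close> to \<open>y\<close>. A formula violating preservation at this pair makes both
    sides of the equivalence false.\<close>
  have "(x, y) \<notin> preservation ?L M N"
    using False preservation_bisimulation[OF assms(1-5)] by blast
  with False assms(6,7) show ?thesis
    unfolding preservation_def by blast
qed

lemma relevant_directed_bisimulation_commute:
  "relevant_directed_bisimulation AP M N Z Z' \<longleftrightarrow> relevant_directed_bisimulation AP N M Z' Z"
  unfolding relevant_directed_bisimulation_def by blast

theorem theorem8:
  fixes AP :: "'p set"
    and K :: "('w, 'p) rm_struct set"
    and M1 M2 :: "('w, 'p) rm_struct"
    and w1 w2 :: 'w
    and \<kappa> :: "'k rel"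
    and \<Lambda> :: "'l rel"
  assumes "K \<subseteq> V_B AP"
    and "M1 \<in> K" and "M2 \<in> K"
    and "w1 \<in> worlds M1" and "w2 \<in> worlds M2"
    and "least_infinite_cardinal_above \<kappa> |worlds M1| |worlds M2|"
    and "cardinal_sup \<Lambda> |AP| (ctwo ^c \<kappa>)"
  shows "(\<exists>\<theta> :: ('p, 'l) fm. \<theta> \<in> Lang (cardSuc \<Lambda>) AP \<and>
            sat M1 \<theta> w1 \<and>
            (sat M2 \<theta> w2 \<longleftrightarrow>
               (\<exists>Z1 Z2. relevant_directed_bisimulation AP M1 M2 Z1 Z2 \<and> (w1, w2) \<in> Z1))) \<and>
         (\<exists>\<theta> :: ('p, 'l) fm. \<theta> \<in> Lang (cardSuc \<Lambda>) AP \<and>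
            sat M2 \<theta> w2 \<and>
            (sat M1 \<theta> w1 \<longleftrightarrow>
               (\<exists>Z1 Z2. relevant_directed_bisimulation AP M1 M2 Z1 Z2 \<and> (w2, w1) \<in> Z2)))"
proof -
  have models: "rm_model AP M1" "rm_model AP M2"
    using assms(1-3) unfolding V_B_def by auto
  have \<kappa>: "Card_order \<kappa>" "|worlds M1| \<le>o \<kappa>" "|worlds M2| \<le>o \<kappa>"
    using assms(6) unfolding least_infinite_cardinal_above_def by auto
  have \<Lambda>: "Card_order \<Lambda>" "ctwo ^c \<kappa> \<le>o \<Lambda>"
    using assms(7) unfolding cardinal_sup_def by auto
  \<comment> \<open>By Cantor, \<kappa> lies strictly below its power, hence below \<Lambda>, so
    conjunctions and disjunctions over the worlds of either model are in the language.\<close>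
  have "\<kappa> \<le>o \<Lambda>"
    using ordLess_imp_ordLeq[OF ordLess_ctwo_cexp[OF \<kappa>(1)]] \<Lambda>(2) by (rule ordLeq_transitive)
  then have "|worlds M1| \<le>o \<Lambda>" "|worlds M2| \<le>o \<Lambda>"
    using \<kappa>(2,3) ordLeq_transitive by blast+
  note * = \<Lambda>(1) this models assms(4,5)
  show ?thesis
    \<comment> \<open>The permuted facts exchange the two models. The resulting bisimulations run
      from \<open>M2\<close> to \<open>M1\<close> and are turned around to match the order in the
      goal.\<close>
    using separating_formula_ex[OF *] separating_formula_ex[OF *(1,3,2,5,4,7,6)]
    by (subst (asm) (2) relevant_directed_bisimulation_commute) blast
qed

end
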